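(* For every constant $C>0$ there exists a constant $c>0$ such that for infinitely many positive integers $n$ there is an $n$-vertex directed unweighted graph $G=(V,E)$ with $m=|E|$ edges such that for every shortcut set $H$ of $G$ with $|H|\le Cm$, the graph $G\cup H$ has diameter at least $c\,n^{1/5}$.
   Context: For a directed graph $G=(V,E)$, a shortcut set is a set $H$ of ordered pairs $(u,v)$ of distinct vertices such that $v$ is reachable from $u$ in $G$. $G\cup H$ denotes $(V,E\cup H)$. The diameter of a directed graph is $\max \mathrm{dist}(u,v)$ over all ordered pairs $(u,v)$ with $v$ reachable from $u$, with $\mathrm{dist}$ the unweighted shortest-path distance. *)

theory Defs
  imports "Graph_Theory.Pair_Digraph" "Graph_Theory.Shortest_Path"
begin

definition shortcut_set :: "'a pair_pre_digraph \<Rightarrow> 'a rel \<Rightarrow> bool" where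
  "shortcut_set G H \<longleftrightarrow>
     (\<forall>(u, v) \<in> H. u \<in> pverts G \<and> v \<in> pverts G \<and> u \<noteq> v \<and> u \<rightarrow>\<^sup>*\<^bsub>with_proj G\<^esub> v)"

definition add_arcs :: "'a pair_pre_digraph \<Rightarrow> 'a rel \<Rightarrow> 'a pair_pre_digraph" where
  "add_arcs G H = \<lparr> pverts = pverts G, parcs = parcs G \<union> H \<rparr>"

(* Every arc has weight 1, so the cost of a walk is its number of arcs. *)
definition unweighted_dist :: "'a pair_pre_digraph \<Rightarrow> 'a \<Rightarrow> 'a \<Rightarrow> ereal" where
  "unweighted_dist G u v = wf_digraph.\<mu> (with_proj G) (\<lambda>_. 1) u v"

(* Unreachable pairs are left out, so the diameter is finite even if the graph is not
   strongly connected. Max is meaningful for finite graphs with at least one vertex. *)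
definition digraph_diameter :: "'a pair_pre_digraph \<Rightarrow> ereal" where
  "digraph_diameter G = Max {unweighted_dist G u v | u v.
     u \<in> pverts G \<and> v \<in> pverts G \<and> u \<rightarrow>\<^sup>*\<^bsub>with_proj G\<^esub> v}"

end

theory Submission
  imports Defs
begin

text \<open>
  Let \<open>D = 2 ^ k\<close>. The graph has layers \<open>0, \<dots>, D\<close>, each a box of \<open>2 D \<times> 2 D \<times> 8 D\<^sup>2\<close> integer points,
  and the arcs leaving layer \<open>l\<close> add \<open>(a, b, 2 w (a + b))\<close> with \<open>a, b \<in> {0, 1}\<close>, where \<open>w\<close> is the
  \<open>k\<close>-bit reversal of \<open>l\<close>. For a direction \<open>(c, d) \<in> {0..<D}\<^sup>2\<close>, the functional
  \<open>(2 c + 1) x + (2 d + 1) y - z\<close> has in each layer a unique best move, namely \<open>a = [w \<le> c]\<close> and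
  \<open>b = [w \<le> d]\<close>; hence the path that always takes it is the only path between its endpoints.
  Any window of \<open>L\<close> consecutive layers has thresholds \<open>w\<close> spread evenly at scale \<open>D / L\<close>, so two
  vertices at layer distance \<open>L\<close> lie together on at most \<open>(4 D / L)\<^sup>2\<close> of these paths.

  Fix a constant \<open>M\<close>. A shortcut that spans \<open>L > M\<close> layers thus covers in total at most
  \<open>16 D\<^sup>2 / L < 16 D\<^sup>2 / M\<close> layers, summed over all these paths, whereas the paths, \<open>4 D\<^sup>6\<close> in number,
  have \<open>4 D\<^sup>7\<close> layers to be covered. As there are only \<open>O(C D\<^sup>5)\<close> shortcuts, for large \<open>M\<close> some
  path has fewer than \<open>D / 2\<close> of its layers covered by long shortcuts, and traversing the rest takes at
  least \<open>D / (2 M)\<close> arcs. The number of vertices is of order \<open>D\<^sup>5\<close>.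
\<close>

section \<open>Bit reversal\<close>

fun bitrev :: "nat \<Rightarrow> nat \<Rightarrow> nat" where
  "bitrev 0 i = 0"
| "bitrev (Suc k) i = 2 ^ k * (i mod 2) + bitrev k (i div 2)"

lemma bitrev_less: "bitrev k i < 2 ^ k"
proof (induction k arbitrary: i)
  case (Suc k)
  have "bitrev k (i div 2) < 2 ^ k" by (rule Suc)
  moreover have "i mod 2 = 0 \<or> i mod 2 = 1" by presburger
  ultimately show ?case by auto
qed simp

text \<open>The low bits of \<open>i\<close> become the leading bits of \<open>bitrev k i\<close>,
  and \<open>2 ^ j\<close> consecutive numbers run through all residues mod \<open>2 ^ j\<close>. In
  the induction, the top bit of \<open>a\<close> fixes the parity of \<open>i\<close>.\<close>

lemma bitrev_hits:
  assumes "j \<le> k" "a < 2 ^ j"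
  shows "\<exists>i. i0 \<le> i \<and> i < i0 + 2 ^ j \<and> bitrev k i div 2 ^ (k - j) = a"
  using assms
proof (induction k arbitrary: j a i0)
  case 0
  then show ?case by auto
next
  case (Suc k)
  show ?case
  proof (cases j)
    case 0
    with Suc.prems show ?thesis using bitrev_less[of "Suc k" i0] by (intro exI[of _ i0]) auto
  next
    case (Suc j')
    define b where "b = a div 2 ^ j'"
    have b: "b < 2"
      using Suc.prems(2) Suc by (simp add: b_def less_mult_imp_div_less)
    have jk: "j' \<le> k" using Suc Suc.prems(1) by simp
    have "a mod 2 ^ j' < 2 ^ j'" by simp
    \<comment> \<open>\<open>(i0 + 1 - b) div 2\<close> is the least \<open>i\<close> with
      \<open>i0 \<le> 2 * i + b\<close>.\<close>
    from Suc.IH[OF jk this, of "(i0 + 1 - b) div 2"] obtain i where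
      i: "(i0 + 1 - b) div 2 \<le> i" "i < (i0 + 1 - b) div 2 + 2 ^ j'"
        "bitrev k i div 2 ^ (k - j') = a mod 2 ^ j'" by blast
    have split: "2 ^ k = (2::nat) ^ (k - j') * 2 ^ j'"
      using jk by (simp flip: power_add)
    have "bitrev (Suc k) (2 * i + b) div 2 ^ (Suc k - j)
        = (bitrev k i + 2 ^ (k - j') * (2 ^ j' * b)) div 2 ^ (k - j')"
      using b Suc by (simp add: split mult.assoc add.commute)
    also have "\<dots> = 2 ^ j' * b + bitrev k i div 2 ^ (k - j')"
      by (rule div_mult_self2) simp
    also have "\<dots> = a" by (simp add: i(3) b_def)
    finally have "bitrev (Suc k) (2 * i + b) div 2 ^ (Suc k - j) = a" .
    moreover have "i0 \<le> 2 * i + b" "2 * i + b < i0 + 2 ^ j"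
      using i(1,2) b Suc by (auto simp: less_2_cases_iff)
    ultimately show ?thesis by blast
  qed
qed

section \<open>Counting thresholds in a window of layers\<close>

text \<open>Displacement of a greedy path in one coordinate after \<open>i\<close> layers.\<close>

definition cnt :: "nat \<Rightarrow> nat \<Rightarrow> nat \<Rightarrow> nat" where
  "cnt k c i = (\<Sum>l<i. of_bool (bitrev k l \<le> c))"

lemma cnt_le: "cnt k c i \<le> i"
proof -
  have "cnt k c i \<le> (\<Sum>l<i. 1)" unfolding cnt_def by (intro sum_mono) auto
  then show ?thesis by simp
qed

lemma cnt_split:
  assumes "i \<le> j"
  shows "cnt k c j = cnt k c i + (\<Sum>l\<in>{i..<j}. of_bool (bitrev k l \<le> c))"
  using sum.atLeastLessThan_concat[of 0 i j "\<lambda>l. of_bool (bitrev k l \<le> c) :: nat"] assms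
  by (simp add: cnt_def lessThan_atLeast0)

text \<open>Two values whose leading digits differ by at least 2 are separated by the threshold
  \<open>bitrev k l\<close> of some \<open>l\<close> in the window, so their counts over the window differ.\<close>

lemma card_same_cnt:
  assumes "i < j" "j \<le> i + 2 ^ k"
  shows "card {c. c < 2 ^ k \<and> cnt k c j = cnt k c i + a} * (j - i) \<le> 4 * 2 ^ k"
proof -
  let ?S = "{c. c < 2 ^ k \<and> cnt k c j = cnt k c i + a}"
  \<comment> \<open>The window contains \<open>2 ^ e\<close> consecutive layers, enough for a
    threshold in every block of length \<open>2 ^ (k - e)\<close>, and is less than twice as
    long.\<close>
  obtain e where e: "2 ^ e \<le> j - i" "j - i < 2 ^ (e + 1)"
    using ex_power_ivl1[of 2 "j - i"] assms(1) by (metis Suc_leI One_nat_def order.refl zero_less_diff)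
  have ek: "e \<le> k"
  proof (rule ccontr)
    assume "\<not> e \<le> k"
    then have "2 ^ k < (2::nat) ^ e" by simp
    with e(1) assms show False by linarith
  qed
  define B :: nat where "B = 2 ^ (k - e)"
  have Bpos: "B > 0" by (simp add: B_def)
  have Be: "2 ^ k = B * 2 ^ e" using ek by (simp add: B_def flip: power_add)
  show ?thesis
  proof (cases "?S = {}")
    case False
    define m where "m = Min ?S"
    have fin: "finite ?S" by (rule finite_subset[of _ "{..<2 ^ k}"]) auto
    have m: "m \<in> ?S" unfolding m_def using fin False by (rule Min_in)
    have near: "c div B \<le> m div B + 1" if c: "c \<in> ?S" for c
    proof (rule ccontr)
      assume far: "\<not> c div B \<le> m div B + 1"
      have "c div B < 2 ^ e"
        using c Bpos Be by (simp add: less_mult_imp_div_less mult.commute)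
      with far have "m div B + 1 < 2 ^ e" by simp
      from bitrev_hits[OF ek this, of i] obtain l where
        l: "i \<le> l" "l < i + 2 ^ e" "bitrev k l div B = m div B + 1"
        by (auto simp: B_def)
      have lj: "l \<in> {i..<j}" using l e assms by simp
      have ml: "m < bitrev k l"
        using l(3) div_le_mono[of "bitrev k l" m B] by (cases "m < bitrev k l") auto
      have lc: "bitrev k l \<le> c"
        using l(3) far div_le_mono[of c "bitrev k l" B] by (cases "bitrev k l \<le> c") auto
      have "(\<Sum>l\<in>{i..<j}. of_bool (bitrev k l \<le> m)) < (\<Sum>l\<in>{i..<j}. of_bool (bitrev k l \<le> c) :: nat)"
        using ml lc lj by (intro sum_strict_mono_ex1) (auto intro!: bexI[of _ l])
      with c m cnt_split[of i j k m] cnt_split[of i j k c] assms show False by simp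
    qed
    \<comment> \<open>Every member lies in the block of the minimum \<open>m\<close> or in the next
      one.\<close>
    have "?S \<subseteq> {m div B * B ..< m div B * B + 2 * B}"
    proof
      fix c assume c: "c \<in> ?S"
      have "m \<le> c" using fin c by (simp add: m_def)
      then have "m div B * B \<le> c" by (meson div_times_less_eq_dividend le_trans)
      moreover have "c < m div B * B + 2 * B"
      proof -
        have "c < (c div B + 1) * B" using Bpos
          by (simp add: dividend_less_div_times add.commute)
        also have "\<dots> \<le> (m div B + 2) * B" using near[OF c] by (intro mult_right_mono) auto
        finally show ?thesis by (simp add: algebra_simps)
      qed
      ultimately show "c \<in> {m div B * B ..< m div B * B + 2 * B}" by simp
    qed
    then have "card ?S \<le> 2 * B"
      using card_mono[of "{m div B * B ..< m div B * B + 2 * B}" ?S] by simp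
    then have "card ?S * (j - i) \<le> (2 * B) * (2 ^ (e + 1))"
      using e(2) by (intro mult_mono) auto
    also have "\<dots> = 4 * 2 ^ k" by (simp add: Be)
    finally show ?thesis .
  next
    case True
    then show ?thesis by (simp only: card.empty)
  qed
qed

section \<open>The layered graph\<close>

text \<open>Layer and coordinates are coded into one number because the graphs sought have vertices
  of type \<open>nat\<close>.\<close>

definition vtx :: "nat \<Rightarrow> nat \<Rightarrow> nat \<Rightarrow> nat \<Rightarrow> nat" where
  "vtx i x y z = prod_encode (i, prod_encode (x, prod_encode (y, z)))"

definition lay :: "nat \<Rightarrow> nat" where "lay v = fst (prod_decode v)"
definition cx :: "nat \<Rightarrow> nat" where "cx v = fst (prod_decode (snd (prod_decode v)))"
definition cy :: "nat \<Rightarrow> nat" where "cy v = fst (prod_decode (snd (prod_decode (snd (prod_decode v)))))"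
definition cz :: "nat \<Rightarrow> nat" where "cz v = snd (prod_decode (snd (prod_decode (snd (prod_decode v)))))"

lemma vtx_simps [simp]:
  "lay (vtx i x y z) = i" "cx (vtx i x y z) = x" "cy (vtx i x y z) = y" "cz (vtx i x y z) = z"
  "vtx (lay v) (cx v) (cy v) (cz v) = v"
  by (simp_all add: vtx_def lay_def cx_def cy_def cz_def)

lemma vtx_eq_iff: "vtx i x y z = v \<longleftrightarrow> lay v = i \<and> cx v = x \<and> cy v = y \<and> cz v = z"
  by (metis vtx_simps)

text \<open>Each side is twice the range of starting points in \<open>path_params\<close>: a greedy
  path gains at most \<open>2 ^ k\<close> in x and in y and \<open>4 * 2 ^ k * 2 ^ k\<close> in z,
  so it stays inside.\<close>

definition layer_verts :: "nat \<Rightarrow> nat set" where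
  "layer_verts k = {v. lay v \<le> 2 ^ k \<and> cx v < 2 * 2 ^ k \<and> cy v < 2 * 2 ^ k \<and> cz v < 8 * 2 ^ k * 2 ^ k}"

text \<open>The cost in z per unit step is even while the rewards \<open>2 * c + 1\<close> and
  \<open>2 * d + 1\<close> are odd, so the best choice is never tied.\<close>

definition move :: "nat \<Rightarrow> nat \<Rightarrow> nat \<Rightarrow> nat \<Rightarrow> nat" where
  "move k v a b = vtx (Suc (lay v)) (cx v + a) (cy v + b) (cz v + 2 * bitrev k (lay v) * (a + b))"

definition layer_graph :: "nat \<Rightarrow> nat pair_pre_digraph" where
  "layer_graph k = \<lparr> pverts = layer_verts k,
     parcs = {(v, move k v a b) | v a b. v \<in> layer_verts k \<and> move k v a b \<in> layer_verts k \<and> a \<le> 1 \<and> b \<le> 1} \<rparr>"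

lemma pverts_layer_graph [simp]: "pverts (layer_graph k) = layer_verts k"
  by (simp add: layer_graph_def)

lemma bij_betw_layer_verts:
  "bij_betw (\<lambda>(i, x, y, z). vtx i x y z)
     ({..2 ^ k} \<times> {..<2 * 2 ^ k} \<times> {..<2 * 2 ^ k} \<times> {..<8 * 2 ^ k * 2 ^ k}) (layer_verts k)"
  by (rule bij_betwI[where g = "\<lambda>v. (lay v, cx v, cy v, cz v)"]) (auto simp: layer_verts_def)

lemma card_layer_verts: "card (layer_verts k) = 32 * (2 ^ k + 1) * (2 ^ k) ^ 4"
  using bij_betw_same_card[OF bij_betw_layer_verts[of k]] by (simp add: card_cartesian_product power4_eq_xxxx algebra_simps)

lemma finite_layer_verts [simp]: "finite (layer_verts k)"
  by (rule card_ge_0_finite) (simp add: card_layer_verts)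

lemma parcs_layer_graph_subset:
  "parcs (layer_graph k) \<subseteq> (\<lambda>(v, a, b). (v, move k v a b)) ` (layer_verts k \<times> {..1} \<times> {..1})"
  by (force simp: layer_graph_def)

lemma card_parcs_layer_graph: "card (parcs (layer_graph k)) \<le> 4 * card (layer_verts k)"
proof -
  have "card (parcs (layer_graph k)) \<le> card (layer_verts k \<times> {..1::nat} \<times> {..1::nat})"
    by (rule order_trans[OF card_mono[OF _ parcs_layer_graph_subset] card_image_le]) auto
  then show ?thesis by (simp add: card_cartesian_product)
qed

lemma pair_digraph_layer_graph: "pair_digraph (layer_graph k)"
proof
  show "finite (parcs (layer_graph k))"
    by (rule finite_subset[OF parcs_layer_graph_subset]) auto
  show "fst e \<noteq> snd e" if "e \<in> parcs (layer_graph k)" for e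
  proof -
    have "lay (fst e) \<noteq> lay (snd e)" using that by (auto simp: layer_graph_def move_def)
    then show ?thesis by auto
  qed
qed (auto simp: layer_graph_def)

section \<open>Greedy paths\<close>

definition wsum :: "nat \<Rightarrow> nat \<Rightarrow> nat \<Rightarrow> nat" where
  "wsum k c i = (\<Sum>l<i. 2 * bitrev k l * of_bool (bitrev k l \<le> c))"

text \<open>The path starts at the point \<open>(x, y, z)\<close> of layer 0; in layer \<open>l\<close> it uses the move
  of largest scalar product with the direction \<open>(2 * c + 1, 2 * d + 1, -1)\<close>.\<close>

fun pt :: "nat \<Rightarrow> nat \<times> nat \<times> nat \<times> nat \<times> nat \<Rightarrow> nat \<Rightarrow> nat" where
  "pt k (x, y, z, c, d) i = vtx i (x + cnt k c i) (y + cnt k d i) (z + wsum k c i + wsum k d i)"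

definition path_params :: "nat \<Rightarrow> (nat \<times> nat \<times> nat \<times> nat \<times> nat) set" where
  "path_params k = {..<2 ^ k} \<times> {..<2 ^ k} \<times> {..<4 * 2 ^ k * 2 ^ k} \<times> {..<2 ^ k} \<times> {..<2 ^ k}"

lemma lay_pt [simp]: "lay (pt k \<pi> i) = i"
  by (cases \<pi>) simp

lemma wsum_le: "wsum k c i \<le> 2 * 2 ^ k * i"
proof -
  have "wsum k c i \<le> (\<Sum>l<i. 2 * 2 ^ k)" unfolding wsum_def
    using bitrev_less by (intro sum_mono) (auto simp: less_imp_le)
  then show ?thesis by (simp add: mult.commute)
qed

lemma pt_in_verts:
  assumes "\<pi> \<in> path_params k" "i \<le> 2 ^ k"
  shows "pt k \<pi> i \<in> layer_verts k"
proof -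
  obtain x y z c d where \<pi>: "\<pi> = (x, y, z, c, d)" by (cases \<pi>)
  have "wsum k c' i \<le> 2 * (2 ^ k * 2 ^ k)" for c'
    using le_trans[OF wsum_le mult_le_mono2[OF assms(2)]] by (simp add: mult.assoc)
  from this[of c] this[of d] have "wsum k c i + wsum k d i \<le> 4 * (2 ^ k * 2 ^ k)" by simp
  with assms show ?thesis
    using cnt_le[of k c i] cnt_le[of k d i]
    by (auto simp: \<pi> path_params_def layer_verts_def)
qed

lemma pt_Suc:
  "pt k (x, y, z, c, d) (Suc i)
    = move k (pt k (x, y, z, c, d) i) (of_bool (bitrev k i \<le> c)) (of_bool (bitrev k i \<le> d))"
  by (simp add: move_def cnt_def wsum_def algebra_simps)

lemma pt_arc:
  assumes "\<pi> \<in> path_params k" "i < 2 ^ k"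
  shows "(pt k \<pi> i, pt k \<pi> (Suc i)) \<in> parcs (layer_graph k)"
proof -
  obtain x y z c d where \<pi>: "\<pi> = (x, y, z, c, d)" by (cases \<pi>)
  have "pt k \<pi> i \<in> layer_verts k" "pt k \<pi> (Suc i) \<in> layer_verts k"
    using assms by (simp_all add: pt_in_verts)
  moreover have "of_bool P \<le> (1::nat)" for P by simp
  ultimately show ?thesis unfolding \<pi> pt_Suc layer_graph_def by fastforce
qed

lemma reachable_pt:
  assumes "\<pi> \<in> path_params k" "i \<le> 2 ^ k"
  shows "pt k \<pi> 0 \<rightarrow>\<^sup>*\<^bsub>with_proj (layer_graph k)\<^esub> pt k \<pi> i"
proof -
  interpret pair_digraph "layer_graph k" by (rule pair_digraph_layer_graph)
  show ?thesis using assms(2)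
  proof (induction i)
    case 0
    then show ?case using pt_in_verts[OF assms(1), of 0] by simp
  next
    case (Suc i)
    then show ?case using pt_arc[OF assms(1), of i] reachable_adj_trans by simp
  qed
qed

section \<open>The potential of a direction\<close>

text \<open>Each summand is the maximum of 0 and \<open>2 * c + 1 - 2 * w\<close> for the threshold
  \<open>w\<close> of layer \<open>l\<close>: the most one coordinate can win there.\<close>

definition gain :: "nat \<Rightarrow> nat \<Rightarrow> nat \<Rightarrow> int" where
  "gain k c i = (\<Sum>l<i. of_bool (bitrev k l \<le> c) * (2 * int c + 1 - 2 * int (bitrev k l)))"

text \<open>The linear functional minus its largest possible increase since layer 0. Thus no arc
  raises it, and only greedy moves keep it.\<close>

fun pot :: "nat \<Rightarrow> nat \<times> nat \<times> nat \<times> nat \<times> nat \<Rightarrow> nat \<Rightarrow> int" where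
  "pot k (x, y, z, c, d) v =
     (2 * int c + 1) * int (cx v) + (2 * int d + 1) * int (cy v) - int (cz v)
       - gain k c (lay v) - gain k d (lay v)"

lemma gain_eq: "gain k c i = (2 * int c + 1) * int (cnt k c i) - int (wsum k c i)"
  by (induction i) (auto simp: gain_def cnt_def wsum_def algebra_simps)

lemma pot_pt: "pot k \<pi> (pt k \<pi> i) = pot k \<pi> (pt k \<pi> 0)"
  by (cases \<pi>) (simp add: gain_eq algebra_simps cnt_def wsum_def)

text \<open>The second factor is odd, hence nonzero, and positive exactly when
  \<open>w \<le> c\<close>; the other choice therefore loses strictly.\<close>

lemma move_loss:
  assumes "a \<le> (1::nat)"
  shows "(int a - of_bool (w \<le> c)) * (2 * int c + 1 - 2 * int w) \<le> 0"
    and "(int a - of_bool (w \<le> c)) * (2 * int c + 1 - 2 * int w) = 0 \<Longrightarrow> a = of_bool (w \<le> c)"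
proof -
  have "a = 0 \<or> a = 1" using assms by auto
  then show "(int a - of_bool (w \<le> c)) * (2 * int c + 1 - 2 * int w) \<le> 0" by (auto simp: of_bool_def)
  assume "(int a - of_bool (w \<le> c)) * (2 * int c + 1 - 2 * int w) = 0"
  moreover have "2 * int c + 1 - 2 * int w \<noteq> 0" by presburger
  ultimately show "a = of_bool (w \<le> c)" by (auto simp: of_bool_def split: if_splits)
qed

lemma pot_move:
  "pot k (x, y, z, c, d) (move k v a b) = pot k (x, y, z, c, d) v
     + (int a - of_bool (bitrev k (lay v) \<le> c)) * (2 * int c + 1 - 2 * int (bitrev k (lay v)))
     + (int b - of_bool (bitrev k (lay v) \<le> d)) * (2 * int d + 1 - 2 * int (bitrev k (lay v)))"
  by (simp add: move_def gain_def algebra_simps)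

lemma arc_pot:
  assumes "(u, v) \<in> parcs (layer_graph k)"
  shows "lay v = Suc (lay u)" "pot k \<pi> v \<le> pot k \<pi> u"
    "pot k \<pi> v = pot k \<pi> u \<Longrightarrow> u = pt k \<pi> (lay u) \<Longrightarrow> v = pt k \<pi> (lay v)"
proof -
  obtain x y z c d where \<pi>: "\<pi> = (x, y, z, c, d)" by (cases \<pi>)
  obtain a b where v: "v = move k u a b" and ab: "a \<le> 1" "b \<le> 1"
    using assms by (auto simp: layer_graph_def)
  show lay: "lay v = Suc (lay u)" by (simp add: v move_def)
  note loss = move_loss[OF ab(1), of "bitrev k (lay u)" c] move_loss[OF ab(2), of "bitrev k (lay u)" d]
  note change = pot_move[of k x y z c d u a b, folded v \<pi>]
  show "pot k \<pi> v \<le> pot k \<pi> u" using loss(1,3) change by linarith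
  assume "pot k \<pi> v = pot k \<pi> u" and u: "u = pt k \<pi> (lay u)"
  \<comment> \<open>Two nonpositive losses that add up to zero both vanish.\<close>
  with loss(1,3) change have
    "(int a - of_bool (bitrev k (lay u) \<le> c)) * (2 * int c + 1 - 2 * int (bitrev k (lay u))) = 0"
    "(int b - of_bool (bitrev k (lay u) \<le> d)) * (2 * int d + 1 - 2 * int (bitrev k (lay u))) = 0"
    by linarith+
  then have "a = of_bool (bitrev k (lay u) \<le> c)" "b = of_bool (bitrev k (lay u) \<le> d)"
    using loss(2,4) by blast+
  with v have "v = move k u (of_bool (bitrev k (lay u) \<le> c)) (of_bool (bitrev k (lay u) \<le> d))"
    by simp
  also have "\<dots> = pt k \<pi> (lay v)"
    unfolding lay \<pi> pt_Suc using u unfolding \<pi> by simp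
  finally show "v = pt k \<pi> (lay v)" .
qed

text \<open>As no arc raises the potential, equal values at both ends force every arc between to be
  greedy. This carries the uniqueness of greedy paths over to shortcuts.\<close>

lemma reachable_pot:
  assumes "u \<rightarrow>\<^sup>*\<^bsub>with_proj (layer_graph k)\<^esub> v"
  shows "u = v \<or> lay u < lay v" "pot k \<pi> v \<le> pot k \<pi> u"
    "pot k \<pi> v = pot k \<pi> u \<Longrightarrow> u = pt k \<pi> (lay u) \<Longrightarrow> v = pt k \<pi> (lay v)"
proof -
  interpret pair_digraph "layer_graph k" by (rule pair_digraph_layer_graph)
  have "(u = v \<or> lay u < lay v) \<and> pot k \<pi> v \<le> pot k \<pi> u \<and>
    (pot k \<pi> v = pot k \<pi> u \<longrightarrow> u = pt k \<pi> (lay u) \<longrightarrow> v = pt k \<pi> (lay v))"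
    using assms
  proof (induction rule: reachable_induct)
    case (step w v)
    then have "(w, v) \<in> parcs (layer_graph k)" by simp
    from arc_pot(1)[OF this] arc_pot(2,3)[OF this, of \<pi>] step.IH show ?case by (metis less_Suc_eq order.antisym order.trans)
  qed simp
  then show "u = v \<or> lay u < lay v" "pot k \<pi> v \<le> pot k \<pi> u"
    "pot k \<pi> v = pot k \<pi> u \<Longrightarrow> u = pt k \<pi> (lay u) \<Longrightarrow> v = pt k \<pi> (lay v)" by blast+
qed

section \<open>Long shortcuts\<close>

text \<open>The truncated subtraction is exact for shortcuts, as they lead to later layers.\<close>

definition jump :: "nat \<times> nat \<Rightarrow> nat" where
  "jump h = lay (snd h) - lay (fst h)"

definition on_path :: "nat \<Rightarrow> nat \<times> nat \<times> nat \<times> nat \<times> nat \<Rightarrow> nat \<times> nat \<Rightarrow> bool" where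
  "on_path k \<pi> h \<longleftrightarrow> fst h = pt k \<pi> (lay (fst h)) \<and> snd h = pt k \<pi> (lay (snd h))"

text \<open>By \<open>card_same_cnt\<close>, the displacement in x leaves few values of
  \<open>c\<close> and that in y few values of \<open>d\<close>; then \<open>u\<close> and
  \<open>(c, d)\<close> determine the starting point.\<close>

lemma card_on_path:
  assumes "lay u < lay v" "lay v \<le> 2 ^ k"
  shows "card {\<pi> \<in> path_params k. on_path k \<pi> (u, v)} * (jump (u, v) * jump (u, v)) \<le> 16 * 2 ^ k * 2 ^ k"
proof -
  let ?P = "{\<pi> \<in> path_params k. on_path k \<pi> (u, v)}"
  let ?S = "\<lambda>a. {c. c < 2 ^ k \<and> cnt k c (lay v) = cnt k c (lay u) + a}"
  have fin: "finite (?S a)" for a by (rule finite_subset[of _ "{..<2 ^ k}"]) auto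
  have S: "card (?S a) * jump (u, v) \<le> 4 * 2 ^ k" for a
    unfolding jump_def using card_same_cnt[of "lay u" "lay v" k a] assms by simp
  have P: "on_path k (x, y, z, c, d) (u, v) \<longleftrightarrow>
      cx u = x + cnt k c (lay u) \<and> cx v = x + cnt k c (lay v) \<and>
      cy u = y + cnt k d (lay u) \<and> cy v = y + cnt k d (lay v) \<and>
      cz u = z + wsum k c (lay u) + wsum k d (lay u) \<and> cz v = z + wsum k c (lay v) + wsum k d (lay v)"
    for x y z c d
    using vtx_eq_iff[of "lay u" _ _ _ u] vtx_eq_iff[of "lay v" _ _ _ v]
    by (auto simp: on_path_def eq_commute[of _ "vtx _ _ _ _"])
  let ?f = "\<lambda>(x :: nat, y :: nat, z :: nat, c :: nat, d :: nat). (c, d)"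
  have "inj_on ?f ?P" by (auto simp: inj_on_def P)
  moreover have "?f ` ?P \<subseteq> ?S (cx v - cx u) \<times> ?S (cy v - cy u)"
  proof
    fix q assume "q \<in> ?f ` ?P"
    then obtain x y z c d where q: "q = (c, d)"
      and *: "(x, y, z, c, d) \<in> path_params k" "on_path k (x, y, z, c, d) (u, v)" by auto
    have "cnt k c (lay u) \<le> cnt k c (lay v)" "cnt k d (lay u) \<le> cnt k d (lay v)"
      using assms cnt_split[of "lay u" "lay v" k] by simp_all
    with * show "q \<in> ?S (cx v - cx u) \<times> ?S (cy v - cy u)"
      by (auto simp: q P path_params_def)
  qed
  ultimately have "card ?P \<le> card (?S (cx v - cx u) \<times> ?S (cy v - cy u))"
    using fin by (intro card_inj_on_le[where f = ?f]) auto
  then have "card ?P * (jump (u, v) * jump (u, v))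
      \<le> (card (?S (cx v - cx u)) * card (?S (cy v - cy u))) * (jump (u, v) * jump (u, v))"
    by (simp add: card_cartesian_product)
  also have "\<dots> = (card (?S (cx v - cx u)) * jump (u, v)) * (card (?S (cy v - cy u)) * jump (u, v))"
    by simp
  also have "\<dots> \<le> (4 * 2 ^ k) * (4 * 2 ^ k)" by (intro mult_mono S) auto
  finally show ?thesis by simp
qed

section \<open>Walks that use shortcuts\<close>

lemma shortcut_arc:
  assumes "shortcut_set (layer_graph k) H" "(u, v) \<in> parcs (layer_graph k) \<union> H"
  shows "u \<rightarrow>\<^sup>*\<^bsub>with_proj (layer_graph k)\<^esub> v" "u \<noteq> v"
proof -
  interpret pair_digraph "layer_graph k" by (rule pair_digraph_layer_graph)
  show "u \<rightarrow>\<^sup>*\<^bsub>with_proj (layer_graph k)\<^esub> v" "u \<noteq> v"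
    using assms no_loops'[of u v] by (auto simp: shortcut_set_def)
qed

lemma finite_shortcut_set: "shortcut_set (layer_graph k) H \<Longrightarrow> finite H"
  by (rule finite_subset[of _ "layer_verts k \<times> layer_verts k"])
     (auto simp: shortcut_set_def layer_graph_def)

lemma walk_pot:
  assumes "shortcut_set (layer_graph k) H" "pcas u p v" "set p \<subseteq> parcs (layer_graph k) \<union> H"
  shows "pot k \<pi> v \<le> pot k \<pi> u"
  using assms(2,3)
proof (induction p arbitrary: u)
  case (Cons e p)
  then have "pot k \<pi> v \<le> pot k \<pi> (snd e)" "(u, snd e) \<in> parcs (layer_graph k) \<union> H" by auto
  with reachable_pot(2)[OF shortcut_arc(1)[OF assms(1)]] show ?case by (meson order.trans)
qed simp

text \<open>A walk that loses no potential stays on the path of \<open>\<pi>\<close>, so its long arcs are pairwise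
  different shortcuts on that path.\<close>

lemma walk_length:
  assumes H: "shortcut_set (layer_graph k) H" and M: "M > 0"
    and "pcas u p v" "set p \<subseteq> parcs (layer_graph k) \<union> H"
    and "u = pt k \<pi> (lay u)" "pot k \<pi> v = pot k \<pi> u"
  shows "lay v \<le> lay u + M * length p
    + (\<Sum>h | h \<in> H \<and> on_path k \<pi> h \<and> M < jump h \<and> lay u \<le> lay (fst h). jump h)"
  using assms(3-)
proof (induction p arbitrary: u)
  case (Cons e p)
  let ?B = "\<lambda>u. {h. h \<in> H \<and> on_path k \<pi> h \<and> M < jump h \<and> lay u \<le> lay (fst h)}"
  define w where "w = snd e"
  have e: "e = (u, w)" and arc: "(u, w) \<in> parcs (layer_graph k) \<union> H"
    and p: "pcas w p v" "set p \<subseteq> parcs (layer_graph k) \<union> H"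
    using Cons.prems by (auto simp: w_def)
  note reach = reachable_pot(1)[OF shortcut_arc(1)[OF H arc]]
    reachable_pot(2,3)[OF shortcut_arc(1)[OF H arc], of \<pi>]
  have lay: "lay u < lay w" using reach(1) shortcut_arc(2)[OF H arc] by simp
  \<comment> \<open>The potential at \<open>w\<close> is squeezed between the equal values at
    \<open>u\<close> and \<open>v\<close>.\<close>
  have pw: "pot k \<pi> w = pot k \<pi> u"
    using reach(2) walk_pot[OF H p, of \<pi>] Cons.prems by simp
  then have w: "w = pt k \<pi> (lay w)" using reach(3) Cons.prems by blast
  from Cons.IH[OF p w] pw Cons.prems
  have IH: "lay v \<le> lay w + M * length p + (\<Sum>h\<in>?B w. jump h)" by simp
  have fin: "finite (?B x)" for x using finite_shortcut_set[OF H] by simp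
  have sub: "?B w \<subseteq> ?B u" using lay by auto
  show ?case
  proof (cases "jump (u, w) \<le> M")
    case True
    have "(\<Sum>h\<in>?B w. jump h) \<le> (\<Sum>h\<in>?B u. jump h)"
      using fin sub by (intro sum_mono2) auto
    with IH True lay show ?thesis by (simp add: jump_def)
  next
    case False
    have "(u, w) \<in> H"
    proof (rule ccontr)
      assume "(u, w) \<notin> H"
      with arc have "(u, w) \<in> parcs (layer_graph k)" by simp
      from arc_pot(1)[OF this] False M show False by (simp add: jump_def)
    qed
    \<comment> \<open>Since \<open>lay u < lay w\<close>, the filter on \<open>lay (fst h)\<close>
      drops \<open>(u, w)\<close> once the walk is at \<open>w\<close>, so no shortcut is charged
      twice.\<close>
    then have "(u, w) \<in> ?B u" "(u, w) \<notin> ?B w"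
      using False lay w Cons.prems(3) by (auto simp: on_path_def)
    then have "jump (u, w) + (\<Sum>h\<in>?B w. jump h) = (\<Sum>h\<in>insert (u, w) (?B w). jump h)"
      using fin by simp
    also have "\<dots> \<le> (\<Sum>h\<in>?B u. jump h)"
      using fin sub \<open>(u, w) \<in> ?B u\<close> by (intro sum_mono2) auto
    finally show ?thesis using IH lay by (simp add: jump_def)
  qed
qed simp

section \<open>Double counting of covered layers\<close>

text \<open>After exchanging the sums, a shortcut of jump \<open>L > M\<close> contributes
  \<open>M * L \<le> L * L\<close> for each path through it, and \<open>card_on_path\<close> bounds
  the total.\<close>

lemma sum_jump_on_path:
  assumes H: "shortcut_set (layer_graph k) H"
  shows "M * (\<Sum>\<pi>\<in>path_params k. \<Sum>h | h \<in> H \<and> on_path k \<pi> h \<and> M < jump h. jump h)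
    \<le> card H * (16 * 2 ^ k * 2 ^ k)"
proof -
  have fin: "finite H" "finite (path_params k)"
    using finite_shortcut_set[OF H] by (auto simp: path_params_def)
  have "M * (\<Sum>\<pi>\<in>path_params k. \<Sum>h | h \<in> H \<and> on_path k \<pi> h \<and> M < jump h. jump h)
      = M * (\<Sum>\<pi>\<in>path_params k. \<Sum>h\<in>H. if on_path k \<pi> h \<and> M < jump h then jump h else 0)"
    using fin by (simp add: sum.If_cases Int_def)
  also have "\<dots> = (\<Sum>h\<in>H. M * (\<Sum>\<pi>\<in>path_params k. if on_path k \<pi> h \<and> M < jump h then jump h else 0))"
    by (subst sum.swap) (simp add: sum_distrib_left)
  also have "\<dots> \<le> (\<Sum>h\<in>H. 16 * 2 ^ k * 2 ^ k)"
  proof (rule sum_mono)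
    fix h assume "h \<in> H"
    obtain u v where h: "h = (u, v)" by (cases h)
    from \<open>h \<in> H\<close> h H have reach: "u \<rightarrow>\<^sup>*\<^bsub>with_proj (layer_graph k)\<^esub> v" "u \<noteq> v"
      and v: "lay v \<le> 2 ^ k"
      by (auto simp: shortcut_set_def layer_graph_def layer_verts_def)
    have lay: "lay u < lay v" using reachable_pot(1)[OF reach(1)] reach(2) by simp
    let ?c = "card {\<pi> \<in> path_params k. on_path k \<pi> (u, v)}"
    show "M * (\<Sum>\<pi>\<in>path_params k. if on_path k \<pi> h \<and> M < jump h then jump h else 0) \<le> 16 * 2 ^ k * 2 ^ k"
    proof (cases "M < jump h")
      case True
      have "M * (\<Sum>\<pi>\<in>path_params k. if on_path k \<pi> h \<and> M < jump h then jump h else 0)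
          = ?c * (jump h * M)"
        using True fin h by (simp add: sum.If_cases Int_def)
      also have "\<dots> \<le> ?c * (jump h * jump h)" using True by (intro mult_left_mono) auto
      also have "\<dots> \<le> 16 * 2 ^ k * 2 ^ k" unfolding h by (rule card_on_path[OF lay v])
      finally show ?thesis .
    qed simp
  qed
  finally show ?thesis by simp
qed

text \<open>Averaging: with \<open>D = 2 ^ k\<close>, if all paths were half covered, then
  \<open>4 * M * D ^ 7 \<le> 32 * D ^ 2 * card H\<close>. The graph has at most
  \<open>256 * D ^ 5\<close> arcs, so the right side is at most \<open>8192 * C * D ^ 7\<close>,
  whence the threshold \<open>2048 * C\<close>.\<close>

lemma exists_uncovered_path:
  assumes H: "shortcut_set (layer_graph k) H"
    and card: "real (card H) \<le> C * real (card (parcs (layer_graph k)))"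
    and C: "C > 0" and M: "real M > 2048 * C"
  obtains \<pi> where "\<pi> \<in> path_params k"
    "2 * (\<Sum>h | h \<in> H \<and> on_path k \<pi> h \<and> M < jump h. jump h) < 2 ^ k"
proof (rule ccontr)
  define D :: nat where "D = 2 ^ k"
  have D: "D \<ge> 1" by (simp add: D_def)
  define S where "S = (\<Sum>\<pi>\<in>path_params k. \<Sum>h | h \<in> H \<and> on_path k \<pi> h \<and> M < jump h. jump h)"
  assume "\<not> thesis"
  with that have "\<forall>\<pi>\<in>path_params k. D \<le> 2 * (\<Sum>h | h \<in> H \<and> on_path k \<pi> h \<and> M < jump h. jump h)"
    unfolding D_def by (meson not_le)
  then have "(\<Sum>\<pi>\<in>path_params k. D)
      \<le> (\<Sum>\<pi>\<in>path_params k. 2 * (\<Sum>h | h \<in> H \<and> on_path k \<pi> h \<and> M < jump h. jump h))"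
    by (intro sum_mono) blast
  moreover have "card (path_params k) = 4 * D ^ 6"
    by (simp add: path_params_def card_cartesian_product D_def power_numeral_reduce)
  ultimately have "4 * D ^ 7 \<le> 2 * S"
    by (simp add: S_def sum_distrib_left power_numeral_reduce)
  then have "M * (4 * D ^ 7) \<le> M * (2 * S)" by (rule mult_le_mono2)
  also have "\<dots> = 2 * (M * S)" by simp
  also have "\<dots> \<le> 2 * (card H * (16 * D * D))"
    using sum_jump_on_path[OF H, of M] by (simp add: D_def S_def)
  finally have "real (M * (4 * D ^ 7)) \<le> real (2 * (card H * (16 * D * D)))"
    by (simp only: of_nat_le_iff)
  then have 1: "4 * real M * real D ^ 7 \<le> 32 * real D ^ 2 * real (card H)"
    by (simp add: power2_eq_square mult_ac)
  have "card (layer_verts k) = 32 * (D + 1) * D ^ 4"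
    by (simp add: card_layer_verts D_def)
  also have "\<dots> \<le> 32 * (2 * D) * D ^ 4" using D by (intro mult_mono) auto
  finally have "card (parcs (layer_graph k)) \<le> 256 * D ^ 5"
    using card_parcs_layer_graph[of k] by (simp add: power_numeral_reduce)
  then have "real (card (parcs (layer_graph k))) \<le> real (256 * D ^ 5)"
    by (simp only: of_nat_le_iff)
  then have "C * real (card (parcs (layer_graph k))) \<le> C * (256 * real D ^ 5)"
    using C by (intro mult_left_mono) auto
  with card have "real (card H) \<le> C * (256 * real D ^ 5)" by linarith
  then have "32 * real D ^ 2 * real (card H) \<le> 32 * real D ^ 2 * (C * (256 * real D ^ 5))"
    by (intro mult_left_mono) auto
  with 1 have "4 * real M * real D ^ 7 \<le> 4 * (2048 * C) * real D ^ 7"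
    by (simp add: power_numeral_reduce mult_ac)
  moreover have "real D ^ 7 > 0" using D by simp
  ultimately show False using M by simp
qed

section \<open>Diameter in terms of the number of vertices\<close>

lemma diameter_layer_graph:
  assumes H: "shortcut_set (layer_graph k) H"
    and card: "real (card H) \<le> C * real (card (parcs (layer_graph k)))"
    and C: "C > 0" and M: "real M > 2048 * C"
  shows "digraph_diameter (add_arcs (layer_graph k) H) \<ge> ereal (2 ^ k / (2 * real M))"
proof -
  let ?GH = "add_arcs (layer_graph k) H"
  interpret G: pair_digraph "layer_graph k" by (rule pair_digraph_layer_graph)
  have GH: "pair_wf_digraph ?GH"
    using H G.arc_fst_in_verts G.arc_snd_in_verts
    by unfold_locales (auto simp: add_arcs_def shortcut_set_def)
  interpret GH: pair_wf_digraph ?GH by (rule GH)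
  have Mpos: "M > 0" using C M by (cases M) auto
  obtain \<pi> where \<pi>: "\<pi> \<in> path_params k"
    and few: "2 * (\<Sum>h | h \<in> H \<and> on_path k \<pi> h \<and> M < jump h. jump h) < 2 ^ k"
    using exists_uncovered_path[OF assms] .
  let ?s = "pt k \<pi> 0" and ?t = "pt k \<pi> (2 ^ k)"
  have len: "2 ^ k / (2 * real M) \<le> real (length p)" if "GH.awalk ?s p ?t" for p
  proof -
    from that have "pcas ?s p ?t" "set p \<subseteq> parcs ?GH" unfolding GH.awalk_def by auto
    then have p: "pcas ?s p ?t" "set p \<subseteq> parcs (layer_graph k) \<union> H" by (simp_all add: add_arcs_def)
    \<comment> \<open>Both ends have the same potential, and as \<open>?s\<close> is in layer 0 the
      filter on \<open>lay (fst h)\<close> is vacuous.\<close>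
    from walk_length[OF H Mpos p, of \<pi>] pot_pt[of k \<pi> "2 ^ k"]
    have "2 ^ k \<le> M * length p + (\<Sum>h | h \<in> H \<and> on_path k \<pi> h \<and> M < jump h. jump h)" by simp
    with few have "2 ^ k \<le> 2 * M * length p" by simp
    then have "real (2 ^ k) \<le> real (2 * M * length p)" by (simp only: of_nat_le_iff)
    with Mpos show ?thesis by (simp add: field_simps)
  qed
  have cost: "GH.awalk_cost (\<lambda>_. 1) p = real (length p)" for p :: "(nat \<times> nat) list"
    by (induction p) auto
  have "ereal (2 ^ k / (2 * real M)) \<le> unweighted_dist ?GH ?s ?t"
    unfolding unweighted_dist_def GH.\<mu>_def
    by (rule INF_greatest) (use len in \<open>simp add: cost\<close>)
  also have "\<dots> \<le> digraph_diameter ?GH"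
    unfolding digraph_diameter_def
  proof (rule Max_ge)
    let ?S = "{unweighted_dist ?GH u v | u v.
      u \<in> pverts ?GH \<and> v \<in> pverts ?GH \<and> u \<rightarrow>\<^sup>*\<^bsub>with_proj ?GH\<^esub> v}"
    have "?S \<subseteq> (\<lambda>(u, v). unweighted_dist ?GH u v) ` (layer_verts k \<times> layer_verts k)"
      by (auto simp: add_arcs_def layer_graph_def)
    then show "finite ?S" by (rule finite_subset) simp
    have verts: "?s \<in> pverts ?GH" "?t \<in> pverts ?GH"
      using pt_in_verts[OF \<pi>] by (simp_all add: add_arcs_def layer_graph_def)
    have "(?s, ?t) \<in> (parcs (layer_graph k))\<^sup>*"
      using reachable_rtranclI[OF reachable_pt[OF \<pi> order.refl]] by simp
    then have "(?s, ?t) \<in> (parcs ?GH)\<^sup>*"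
      by (rule rtrancl_mono[THEN subsetD, rotated]) (simp add: add_arcs_def)
    then have "?s \<rightarrow>\<^sup>*\<^bsub>with_proj ?GH\<^esub> ?t" using GH.reachable_conv verts by simp
    with verts show "unweighted_dist ?GH ?s ?t \<in> ?S" by blast
  qed
  finally show ?thesis .
qed

lemma card_layer_verts_powr: "real (card (layer_verts k)) powr (1 / 5) \<le> 4 * 2 ^ k"
proof -
  define D :: nat where "D = 2 ^ k"
  have "card (layer_verts k) = 32 * (D + 1) * D ^ 4"
    by (simp add: card_layer_verts D_def)
  also have "\<dots> \<le> 32 * (2 * D) * D ^ 4" by (intro mult_mono) (auto simp: D_def)
  also have "\<dots> \<le> (4 * D) ^ 5" by (simp add: power_numeral_reduce)
  finally have "real (card (layer_verts k)) \<le> real ((4 * D) ^ 5)" by (simp only: of_nat_le_iff)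
  then have "real (card (layer_verts k)) powr (1 / 5) \<le> real ((4 * D) ^ 5) powr (1 / 5)"
    by (intro powr_mono2) auto
  also have "\<dots> = real (4 * D)"
    unfolding of_nat_power using powr_powr[of "real (4 * D)" 5 "1 / 5"] by (simp add: D_def)
  finally show ?thesis by (simp add: D_def)
qed

theorem theorem1p3:
  shows "\<forall>C::real. C > 0 \<longrightarrow> (\<exists>c::real. c > 0 \<and>
    infinite {n::nat. n > 0 \<and>
      (\<exists>G :: nat pair_pre_digraph. pair_digraph G \<and> card (pverts G) = n \<and>
        (\<forall>H. shortcut_set G H \<and> real (card H) \<le> C * real (card (parcs G)) \<longrightarrow>
           digraph_diameter (add_arcs G H) \<ge> ereal (c * real n powr (1 / 5))))})"
proof (intro allI impI)
  fix C :: real assume C: "C > 0"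
  obtain M :: nat where M: "real M > 2048 * C" using reals_Archimedean2 by blast
  then have Mpos: "real M > 0" using C by linarith
  \<comment> \<open>The bound \<open>2 ^ k / (2 * M)\<close> on the diameter combines with
    \<open>n powr (1 / 5) \<le> 4 * 2 ^ k\<close>.\<close>
  let ?c = "1 / (8 * real M)"
  let ?N = "{n::nat. n > 0 \<and>
      (\<exists>G :: nat pair_pre_digraph. pair_digraph G \<and> card (pverts G) = n \<and>
        (\<forall>H. shortcut_set G H \<and> real (card H) \<le> C * real (card (parcs G)) \<longrightarrow>
           digraph_diameter (add_arcs G H) \<ge> ereal (?c * real n powr (1 / 5))))}"
  have mem: "card (layer_verts k) \<in> ?N" for k
  proof (intro CollectI conjI exI[of _ "layer_graph k"] allI impI)
    fix H assume H: "shortcut_set (layer_graph k) H \<and>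
      real (card H) \<le> C * real (card (parcs (layer_graph k)))"
    have "?c * real (card (layer_verts k)) powr (1 / 5) \<le> ?c * (4 * 2 ^ k)"
      using Mpos by (intro mult_left_mono card_layer_verts_powr) auto
    also have "\<dots> = 2 ^ k / (2 * real M)" by simp
    finally have "ereal (?c * real (card (layer_verts k)) powr (1 / 5)) \<le> ereal (2 ^ k / (2 * real M))"
      by simp
    also have "\<dots> \<le> digraph_diameter (add_arcs (layer_graph k) H)"
      using diameter_layer_graph[OF _ _ C M] H by blast
    finally show "ereal (?c * real (card (layer_verts k)) powr (1 / 5))
      \<le> digraph_diameter (add_arcs (layer_graph k) H)" .
  qed (simp_all add: card_layer_verts pair_digraph_layer_graph)
  have "infinite ?N"
  proof
    assume "finite ?N"
    then obtain b where b: "\<And>n. n \<in> ?N \<Longrightarrow> n < b" using finite_nat_set_iff_bounded by auto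
    \<comment> \<open>The three factors of the cardinality are bounded below separately, by 1,
      \<open>2 ^ b\<close> and 1.\<close>
    have "1 * 2 ^ b * 1 \<le> card (layer_verts b)"
      unfolding card_layer_verts by (intro mult_mono) auto
    moreover have "b < 2 ^ b" by (rule less_exp)
    ultimately show False using b[OF mem[of b]] by simp
  qed
  with Mpos show "\<exists>c>0. infinite {n::nat. n > 0 \<and>
      (\<exists>G :: nat pair_pre_digraph. pair_digraph G \<and> card (pverts G) = n \<and>
        (\<forall>H. shortcut_set G H \<and> real (card H) \<le> C * real (card (parcs G)) \<longrightarrow>
           digraph_diameter (add_arcs G H) \<ge> ereal (c * real n powr (1 / 5))))}"
    by (intro exI[of _ ?c]) simp
qed

end
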